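(* Let $r\ge1$ be an integer and let $\alpha^{(j)}=\langle\alpha_n^{(j)}\rangle_{n\in\mathbb{N}}$, $j=1,\dots,r$, be sequences of real numbers in $(0,1)$ with $\lim_{n\to\infty}\alpha_n^{(1)}=1$. Let $\langle q_n\rangle$ be a sequence in $(0,1)$ with $\lim_{n\to\infty}q_n=1$ and $\lim_{n\to\infty}q_n^n=a$ for some $a\in[0,1)$. Let $p(u)=\sum_{n=1}^\infty p_nu^{n-1}$ be a power series with non-negative coefficients (not all zero) and radius of convergence $R\in(0,\infty]$, such that the associated P-summability method is regular, i.e. $\lim_{u\to R^-}\frac{p_nu^{n-1}}{p(u)}=0$ for all $n\in\mathbb{N}$. Then for every $g\in\mathfrak{C}([0,1])$, $$\lim_{u\to R^-}\frac1{p(u)}\sum_{n=1}^\infty\big\|\mathfrak{R}_{n,q_n}^{\alpha^{(1)},\dots,\alpha^{(r)}}(g)-g\big\|\,p_nu^{n-1}=0,$$ where $\|\cdot\|$ is the sup-norm on $[0,1]$.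
   Context: For $q\in(0,1)$: $[n]_q=\frac{1-q^n}{1-q}$, $(\rho;q)_0=1$ and $(\rho;q)_n=(1-\rho)(1-\rho q)\cdots(1-\rho q^{n-1})$ for $n\ge1$. For $g\in\mathfrak{C}([0,1])$ (continuous real functions on $[0,1]$), $x\in[0,1]$, $n\in\mathbb{N}$, the $q$-Lagrange-Hermite operator is $$\mathfrak{R}_{n,q}^{\alpha^{(1)},\dots,\alpha^{(r)}}(g;x)=\Big\{\prod_{i=1}^r(\alpha_n^{(i)}x^i;q)_n\Big\}\sum_{p=0}^\infty\Bigg\{\sum_{l_1+2l_2+\cdots+rl_r=p}\Big\{\prod_{k=1}^r(q^n;q)_{l_k}\frac{(\alpha_n^{(k)})^{l_k}}{(q;q)_{l_k}}\Big\}\,g\Big(\frac{[l_1]_q}{[n+l_1-1]_q}\Big)\Bigg\}x^p,$$ where the inner sum is over non-negative integers $l_1,\dots,l_r$, and for $n=1$, $l_1=0$ the argument $[0]_q/[0]_q$ of $g$ is read as $0$. (The summation index $p$ here is unrelated to the power series $p(u)$.) *)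

theory Defs
  imports "HOL-Analysis.Analysis"
begin

definition q_int :: "real \<Rightarrow> nat \<Rightarrow> real" where
  "q_int q n = (1 - q ^ n) / (1 - q)"

definition q_pochhammer :: "real \<Rightarrow> real \<Rightarrow> nat \<Rightarrow> real" where
  "q_pochhammer \<rho> q n = (\<Prod>j<n. 1 - \<rho> * q ^ j)"

(* The tuples (l_1, ..., l_r) with l_1 + 2 l_2 + ... + r l_r = m, as extensional functions
   on {1..r}; the set is finite because every weight k is at least 1. *)
definition weighted_tuples :: "nat \<Rightarrow> nat \<Rightarrow> (nat \<Rightarrow> nat) set" where
  "weighted_tuples r m = {l \<in> {1..r} \<rightarrow>\<^sub>E UNIV. (\<Sum>k=1..r. k * l k) = m}"

(* Meant for n >= 1, so that the natural subtraction n + l 1 - 1 never truncates.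
   For n = 1 and l 1 = 0 the argument of g is 0 / 0 = 0, which is the intended convention. *)
definition q_lagrange_hermite ::
    "nat \<Rightarrow> (nat \<Rightarrow> nat \<Rightarrow> real) \<Rightarrow> nat \<Rightarrow> real \<Rightarrow> (real \<Rightarrow> real) \<Rightarrow> real \<Rightarrow> real" where
  "q_lagrange_hermite r \<alpha> n q g x =
     (\<Prod>i=1..r. q_pochhammer (\<alpha> i n * x ^ i) q n) *
     (\<Sum>m. (\<Sum>l\<in>weighted_tuples r m.
              (\<Prod>k=1..r. q_pochhammer (q ^ n) q (l k) * \<alpha> k n ^ l k / q_pochhammer q q (l k)) *
              g (q_int q (l 1) / q_int q (n + l 1 - 1))) * x ^ m)"

definition sup_norm01 :: "(real \<Rightarrow> real) \<Rightarrow> real" where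
  "sup_norm01 f = (SUP x\<in>{0..1}. \<bar>f x\<bar>)"

(* Coefficient sequences are indexed from 1: p(u) is the sum of p_n u^(n-1) over n >= 1.
   The value p 0 is never used. *)
definition power_series_from1 :: "(nat \<Rightarrow> real) \<Rightarrow> real \<Rightarrow> real" where
  "power_series_from1 p u = (\<Sum>n. p (Suc n) * u ^ n)"

definition conv_radius_from1 :: "(nat \<Rightarrow> real) \<Rightarrow> ereal" where
  "conv_radius_from1 p = conv_radius (\<lambda>n. p (Suc n))"

(* The filter on the reals for u tending to R from below, where R may be infinite. *)
definition at_left_ereal :: "ereal \<Rightarrow> real filter" where
  "at_left_ereal R = (if R = \<infinity> then at_top else at_left (real_of_ereal R))"

definition P_regular :: "(nat \<Rightarrow> real) \<Rightarrow> ereal \<Rightarrow> bool" where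
  "P_regular p R \<longleftrightarrow>
     (\<forall>n\<ge>1. ((\<lambda>u. p n * u ^ (n - 1) / power_series_from1 p u) \<longlongrightarrow> 0) (at_left_ereal R))"

end

theory Submission
  imports Defs
begin

text \<open>With \<open>z = \<alpha>\<^sub>n x\<close> for the first sequence, the operator is an average of \<open>g\<close> over the nodes
  \<open>[l]/[n+l-1]\<close> with negative-binomial-type weights. Its first moment is exactly \<open>z\<close> and its second
  moment is at most \<open>z\<^sup>2 + z/[n]\<close>, so the spread about \<open>x\<close> is at most \<open>(\<alpha>\<^sub>n - 1)\<^sup>2 + 1/[n]\<close>, uniformly
  in \<open>x\<close>. Since \<open>[n] = (1 - q\<^sub>n\<^sup>n)/(1 - q\<^sub>n)\<close> tends to infinity when \<open>a < 1\<close>, the operators converge uniformly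
  in the ordinary sense, and a regular P-summability method preserves null sequences.\<close>

subsection \<open>Sums over weighted tuples\<close>

text \<open>For real families unconditional and absolute summability agree, so the norms can be
  summed first over \<open>B\<close>, then over \<open>A\<close>. This drives the induction in
  \<open>has_sum_prod_PiE\<close>.\<close>

lemma summable_on_product_real:
  fixes f :: "'a \<Rightarrow> real" and g :: "'b \<Rightarrow> real"
  assumes "f summable_on A" "g summable_on B"
  shows "(\<lambda>(x, y). f x * g y) summable_on A \<times> B"
proof -
  have f: "(\<lambda>x. norm (f x)) summable_on A" and g: "(\<lambda>y. norm (g y)) summable_on B"
    using assms by (simp_all only: flip: summable_on_iff_abs_summable_on_real)
  have "(\<lambda>z. norm (case z of (x, y) \<Rightarrow> f x * g y)) summable_on A \<times> B"
  proof (rule summable_on_SigmaI)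
    show "((\<lambda>y. norm (case (x, y) of (x, y) \<Rightarrow> f x * g y)) has_sum
        norm (f x) * (\<Sum>\<^sub>\<infinity>y\<in>B. norm (g y))) B" for x
      using has_sum_cmult_right[OF has_sum_infsum[OF g]] by (simp add: abs_mult)
    show "(\<lambda>x. norm (f x) * (\<Sum>\<^sub>\<infinity>y\<in>B. norm (g y))) summable_on A"
      using f by (rule summable_on_cmult_left)
  qed auto
  then show ?thesis
    by (simp only: flip: summable_on_iff_abs_summable_on_real)
qed

text \<open>Distributivity of a finite product over infinite sums. \<open>infsum_prod_PiE\<close>
  yields the value once the family of products is summable; that summability comes by induction on
  \<open>A\<close>, splitting a function on \<open>insert x A\<close> into its value at
  \<open>x\<close> and its restriction to \<open>A\<close>.\<close>

lemma has_sum_prod_PiE: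
  fixes f :: "'a \<Rightarrow> 'b \<Rightarrow> real"
  assumes "finite A" and "\<And>x. x \<in> A \<Longrightarrow> (f x has_sum S x) (B x)"
  shows "((\<lambda>h. \<Prod>x\<in>A. f x (h x)) has_sum (\<Prod>x\<in>A. S x)) (PiE A B)"
proof -
  have summable: "(\<lambda>h. \<Prod>x\<in>A. f x (h x)) summable_on (PiE A B)"
    using assms
  proof (induction A rule: finite_induct)
    case empty
    then show ?case by simp
  next
    case (insert x A)
    have "(\<lambda>h. \<Prod>x\<in>A. f x (h x)) summable_on (PiE A B)"
      using insert.IH insert.prems by blast
    moreover have "f x summable_on B x"
      using insert.prems summable_on_def by blast
    ultimately have "(\<lambda>(y, h). f x y * (\<Prod>x\<in>A. f x (h x))) summable_on (B x \<times> PiE A B)"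
      by (intro summable_on_product_real)
    also have "(\<lambda>(y, h). f x y * (\<Prod>x\<in>A. f x (h x))) =
        (\<lambda>h. \<Prod>x\<in>insert x A. f x (h x)) \<circ> (\<lambda>(y, h). h(x := y))"
    proof -
      have "(\<Prod>z\<in>A. f z (if z = x then y else h z)) = (\<Prod>z\<in>A. f z (h z))" for y and h :: "'a \<Rightarrow> 'b"
        by (rule prod.cong) (use insert.hyps in auto)
      then show ?thesis
        using insert.hyps by (auto simp: fun_eq_iff)
    qed
    finally show ?case
      using inj_combinator[OF insert.hyps(2), of B]
      by (simp only: PiE_insert_eq summable_on_reindex)
  qed
  have "infsum (\<lambda>h. \<Prod>x\<in>A. f x (h x)) (PiE A B) = (\<Prod>x\<in>A. infsum (f x) (B x))"
    using assms summable by (intro infsum_prod_PiE) (auto simp: summable_on_def)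
  also have "\<dots> = (\<Prod>x\<in>A. S x)"
    using assms by (intro prod.cong refl infsumI) auto
  finally show ?thesis
    using summable by (simp add: has_sum_iff)
qed

lemma finite_weighted_tuples: "finite (weighted_tuples r m)"
proof (rule finite_subset)
  show "weighted_tuples r m \<subseteq> {1..r} \<rightarrow>\<^sub>E {..m}"
  proof
    fix l assume l: "l \<in> weighted_tuples r m"
    have "l k \<le> m" if k: "k \<in> {1..r}" for k
    proof -
      have "l k \<le> k * l k"
        using k by simp
      also have "\<dots> \<le> (\<Sum>k=1..r. k * l k)"
        using k by (intro member_le_sum) auto
      finally show ?thesis
        using l by (simp add: weighted_tuples_def)
    qed
    then show "l \<in> {1..r} \<rightarrow>\<^sub>E {..m}"
      using l by (auto simp: weighted_tuples_def PiE_iff)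
  qed
qed (auto intro: finite_PiE)

text \<open>Expanding the product of the r series gives an unconditional sum over all tuples. The
  factors \<open>x ^ (k * l k)\<close> multiply to x raised to the weight of the tuple, so grouping
  the tuples by weight turns the sum into the stated power series.\<close>

lemma weighted_tuples_prod_sums:
  fixes f :: "nat \<Rightarrow> nat \<Rightarrow> real"
  assumes "\<And>k. k \<in> {1..r} \<Longrightarrow> ((\<lambda>j. f k j * x ^ (k * j)) has_sum S k) UNIV"
  shows "(\<lambda>m. (\<Sum>l\<in>weighted_tuples r m. \<Prod>k=1..r. f k (l k)) * x ^ m) sums (\<Prod>k=1..r. S k)"
proof -
  let ?w = "\<lambda>l::nat \<Rightarrow> nat. \<Sum>k=1..r. k * l k"
  have "((\<lambda>l. \<Prod>k=1..r. f k (l k) * x ^ (k * l k)) has_sum (\<Prod>k=1..r. S k)) ({1..r} \<rightarrow>\<^sub>E UNIV)"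
    using assms by (intro has_sum_prod_PiE) auto
  then have "((\<lambda>(m, l). (\<Prod>k=1..r. f k (l k)) * x ^ m) has_sum (\<Prod>k=1..r. S k))
      (SIGMA m:UNIV. weighted_tuples r m)"
    by (rule has_sum_reindex_bij_witness[where i = snd and j = "\<lambda>l. (?w l, l)", THEN iffD1, rotated -1])
      (auto simp: weighted_tuples_def power_sum prod.distrib)
  then have "((\<lambda>m. (\<Sum>l\<in>weighted_tuples r m. \<Prod>k=1..r. f k (l k)) * x ^ m) has_sum
      (\<Prod>k=1..r. S k)) UNIV"
    by (rule has_sum_SigmaD)
      (auto simp: sum_distrib_right intro!: has_sum_finite finite_weighted_tuples)
  then show ?thesis
    by (rule has_sum_imp_sums)
qed

subsection \<open>The \<open>q\<close>-binomial theorem\<close>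

lemma q_pochhammer_0 [simp]: "q_pochhammer \<rho> q 0 = 1"
  by (simp add: q_pochhammer_def)

lemma q_pochhammer_Suc: "q_pochhammer \<rho> q (Suc n) = q_pochhammer \<rho> q n * (1 - \<rho> * q ^ n)"
  by (simp add: q_pochhammer_def)

lemma q_pochhammer_Suc_left:
  "q_pochhammer \<rho> q (Suc n) = (1 - \<rho>) * q_pochhammer (\<rho> * q) q n"
  unfolding q_pochhammer_def prod.lessThan_Suc_shift by (simp add: mult.assoc)

lemma q_pochhammer_nonneg:
  assumes "0 \<le> q" "q \<le> 1" "\<rho> \<le> 1" "0 \<le> \<rho>"
  shows "q_pochhammer \<rho> q n \<ge> 0"
  unfolding q_pochhammer_def using assms by (intro prod_nonneg) (simp add: mult_le_one power_le_one)

lemma q_pochhammer_pos: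
  assumes "0 \<le> q" "q \<le> 1" "0 \<le> \<rho>" "\<rho> < 1"
  shows "q_pochhammer \<rho> q n > 0"
  unfolding q_pochhammer_def
proof (rule prod_pos)
  fix j
  have "\<rho> * q ^ j \<le> \<rho> * 1"
    using assms by (intro mult_left_mono power_le_one) auto
  then show "1 - \<rho> * q ^ j > 0"
    using assms by simp
qed

text \<open>For n \<ge> 1 and 0 < q < 1 this is the Gaussian binomial coefficient with upper index n
  + l - 1 and lower index l.\<close>

definition q_coeff :: "real \<Rightarrow> nat \<Rightarrow> nat \<Rightarrow> real" where
  "q_coeff q n l = q_pochhammer (q ^ n) q l / q_pochhammer q q l"

lemma q_coeff_0_right [simp]: "q_coeff q n 0 = 1"
  by (simp add: q_coeff_def)

lemma q_coeff_nonneg: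
  assumes "0 < q" "q < 1"
  shows "q_coeff q n l \<ge> 0"
  unfolding q_coeff_def using assms
  by (intro divide_nonneg_nonneg q_pochhammer_nonneg) (auto simp: power_le_one)

text \<open>The q-Pascal rule. Over the common denominator \<open>D * (1 - Q)\<close> it amounts to
  1 - q^n Q = (1 - q^n) + q^n (1 - Q).\<close>

lemma q_coeff_Suc_Suc:
  assumes "0 < q" "q < 1"
  shows "q_coeff q (Suc n) (Suc l) = q_coeff q n (Suc l) + q ^ n * q_coeff q (Suc n) l"
proof -
  define P D Q where "P = q_pochhammer (q ^ Suc n) q l" and "D = q_pochhammer q q l"
    and "Q = q ^ Suc l"
  have D: "D > 0"
    unfolding D_def using assms by (intro q_pochhammer_pos) auto
  have Q: "Q < 1"
    unfolding Q_def using assms by (intro power_Suc_less_one) auto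
  have "q_coeff q (Suc n) (Suc l) = P * (1 - q ^ n * Q) / (D * (1 - Q))"
    by (simp add: q_coeff_def q_pochhammer_Suc P_def D_def Q_def mult_ac)
  moreover have "q_coeff q n (Suc l) = (1 - q ^ n) * P / (D * (1 - Q))"
    by (simp add: q_coeff_def q_pochhammer_Suc[of q q] q_pochhammer_Suc_left[of "q ^ n"]
        P_def D_def Q_def mult_ac)
  moreover have "q_coeff q (Suc n) l = P / D"
    by (simp add: q_coeff_def P_def D_def)
  moreover have "P * (1 - q ^ n * Q) / (D * (1 - Q)) =
      (1 - q ^ n) * P / (D * (1 - Q)) + q ^ n * (P / D)"
    using D Q by (simp add: divide_simps) (simp add: algebra_simps)
  ultimately show ?thesis
    by simp
qed

text \<open>Since the upper parameter is an integral power q^n, infinite products are avoided: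
  passing from n to n + 1 multiplies the generating function by the geometric series of 1 / (1 - q^n
  z).\<close>

theorem q_binomial:
  assumes q: "0 < q" "q < 1" and z: "0 \<le> z" "z < 1"
  shows "(\<lambda>l. q_coeff q n l * z ^ l) sums (1 / q_pochhammer z q n)"
proof (induction n)
  case 0
  \<comment> \<open>The first factor of the numerator is 1 - q^0 = 0, so only the constant term
    survives.\<close>
  have "q_coeff q 0 (Suc l) = 0" for l
    by (simp add: q_coeff_def q_pochhammer_Suc_left)
  then have "(\<lambda>l. q_coeff q 0 l * z ^ l) = (\<lambda>l. if l = 0 then 1 else 0)"
    by (auto simp: fun_eq_iff gr0_conv_Suc)
  then show ?case
    using sums_single[of 0 "\<lambda>_. 1::real"] by simp
next
  case (Suc n)
  \<comment> \<open>Iterating the q-Pascal rule in l exhibits the new coefficients as the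
    convolution of the old ones with the powers of q^n, which is the shape of a Cauchy
    product.\<close>
  have conv: "q_coeff q (Suc n) l = (\<Sum>i\<le>l. q_coeff q n i * (q ^ n) ^ (l - i))" for l
  proof (induction l)
    case (Suc l)
    have "(\<Sum>i\<le>l. q_coeff q n i * (q ^ n) ^ (Suc l - i)) = q ^ n * q_coeff q (Suc n) l"
      by (simp add: Suc Suc_diff_le sum_distrib_left mult_ac)
    then show ?case
      using q by (simp add: q_coeff_Suc_Suc)
  qed simp
  have "q ^ n * z \<le> 1 * z"
    using q z by (intro mult_right_mono power_le_one) auto
  then have b: "0 \<le> q ^ n * z" "q ^ n * z < 1"
    using q z by auto
  have "(\<lambda>l. \<Sum>i\<le>l. (q_coeff q n i * z ^ i) * (q ^ n * z) ^ (l - i)) sums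
      ((\<Sum>l. q_coeff q n l * z ^ l) * (\<Sum>l. (q ^ n * z) ^ l))"
    using Suc.IH q z b q_coeff_nonneg[OF q]
    by (intro Cauchy_product_sums) (auto simp: sums_iff abs_mult)
  also have "(\<lambda>l. \<Sum>i\<le>l. (q_coeff q n i * z ^ i) * (q ^ n * z) ^ (l - i)) =
      (\<lambda>l. q_coeff q (Suc n) l * z ^ l)"
    unfolding conv sum_distrib_right
    by (intro ext sum.cong refl) (auto simp: power_mult_distrib simp flip: power_add)
  also have "(\<Sum>l. q_coeff q n l * z ^ l) * (\<Sum>l. (q ^ n * z) ^ l) = 1 / q_pochhammer z q (Suc n)"
    using Suc.IH b by (simp add: sums_iff suminf_geometric q_pochhammer_Suc mult.commute)
  finally show ?case .
qed

subsection \<open>Moments\<close>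

lemma q_int_Suc: "q \<noteq> 1 \<Longrightarrow> q_int q (Suc n) = 1 + q * q_int q n"
  by (simp add: q_int_def field_simps)

lemma q_int_nonneg:
  assumes "0 < q" "q < 1"
  shows "q_int q n \<ge> 0"
  unfolding q_int_def using assms by (simp add: power_le_one)

lemma q_int_pos:
  assumes "0 < q" "q < 1" "n \<ge> 1"
  shows "q_int q n > 0"
  unfolding q_int_def using assms power_Suc_less_one[of q "n - 1"] by simp

lemma q_int_mono:
  assumes "0 < q" "q < 1" "m \<le> n"
  shows "q_int q m \<le> q_int q n"
  unfolding q_int_def using assms by (intro divide_right_mono) (auto intro: power_decreasing)

definition q_node :: "real \<Rightarrow> nat \<Rightarrow> nat \<Rightarrow> real" where
  "q_node q n l = q_int q l / q_int q (n + l - 1)"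

text \<open>The numerator vanishes; for n = 1 so does the denominator, and 0 / 0 = 0 applies. Hence
  the term l = 0 drops out of the first two moments.\<close>

lemma q_node_0 [simp]: "q_node q n 0 = 0"
  by (simp add: q_node_def q_int_def)

lemma q_node_in_01:
  assumes q: "0 < q" "q < 1" and n: "n \<ge> 1"
  shows "q_node q n l \<in> {0..1}"
proof -
  have "q_int q l \<le> q_int q (n + l - 1)"
    using assms by (intro q_int_mono) auto
  then show ?thesis
    using q_int_nonneg[OF q] by (auto simp: q_node_def divide_le_eq_1 less_le)
qed

text \<open>From [l+1] = 1 + q [l] \<le> 1 + [l], with the denominator [n+l] bounded below by [n] in
  one summand and by [n+l-1] in the other. It controls the second moment, where two neighbouring
  nodes meet.\<close>

lemma q_node_Suc_le:
  assumes q: "0 < q" "q < 1" and n: "n \<ge> 1"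
  shows "q_node q n (Suc l) \<le> q_node q n l + 1 / q_int q n"
proof -
  have pos: "q_int q n > 0" "q_int q (n + l) > 0"
    using assms by (auto intro: q_int_pos)
  have "q_node q n (Suc l) = (1 + q * q_int q l) / q_int q (n + l)"
    using q by (simp add: q_node_def q_int_Suc)
  also have "\<dots> \<le> 1 / q_int q (n + l) + q_int q l / q_int q (n + l)"
    using q pos q_int_nonneg[OF q, of l]
    by (simp add: add_divide_distrib divide_right_mono mult_left_le_one_le)
  also have "1 / q_int q (n + l) \<le> 1 / q_int q n"
    using q pos by (intro divide_left_mono q_int_mono) auto
  also have "q_int q l / q_int q (n + l) \<le> q_node q n l"
  proof (cases l)
    case 0
    then show ?thesis by (simp add: q_int_def)
  next
    case (Suc m)
    then have "q_int q (n + l - 1) > 0"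
      using q n by (intro q_int_pos) auto
    then show ?thesis
      unfolding q_node_def using q pos q_int_nonneg[OF q]
      by (intro divide_left_mono q_int_mono) auto
  qed
  finally show ?thesis by simp
qed

text \<open>Consecutive coefficients have the ratio (1 - q^(n+l)) / (1 - q^(l+1)) = [n+l] / [l+1],
  the reciprocal of the node. Multiplying by the node therefore shifts the index by one, which is
  the source of both moment computations.\<close>

lemma q_coeff_node_Suc:
  assumes q: "0 < q" "q < 1" and n: "n \<ge> 1"
  shows "q_coeff q n (Suc l) * q_node q n (Suc l) = q_coeff q n l"
proof -
  have "q_pochhammer q q l > 0"
    using q by (intro q_pochhammer_pos) auto
  moreover have "q * q ^ l < 1"
    using q power_Suc_less_one[of q l] by simp
  moreover have "q ^ (n + l) < 1"
    using q n power_Suc_less_one[of q "n + l - 1"] by simp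
  ultimately show ?thesis
    using q by (simp add: q_coeff_def q_node_def q_int_def q_pochhammer_Suc flip: power_add)
qed

text \<open>The weights are not normalised; their total is \<open>S\<close>. One index shift gives
  the first moment z S exactly. In the second moment the shift absorbs one of the two node factors,
  and \<open>q_node_Suc_le\<close> bounds the other. The exact first moment then makes the expansion
  of the square collapse to (z - x)^2.\<close>

lemma q_second_moment:
  assumes q: "0 < q" "q < 1" and n: "n \<ge> 1" and z: "0 \<le> z" "z < 1"
  defines "S \<equiv> 1 / q_pochhammer z q n"
  obtains V where "(\<lambda>l. q_coeff q n l * z ^ l * (q_node q n l - x)\<^sup>2) sums V"
    and "V \<le> ((z - x)\<^sup>2 + z / q_int q n) * S"
proof -
  let ?c = "\<lambda>l. q_coeff q n l * z ^ l" and ?t = "q_node q n"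
  note c_nonneg = q_coeff_nonneg[OF q, of n]
  have m0: "?c sums S"
    unfolding S_def using q z by (rule q_binomial)
  have shift: "?c (Suc l) * ?t (Suc l) = z * ?c l" for l
    using arg_cong[OF q_coeff_node_Suc[OF q n, of l], of "\<lambda>y. y * (z * z ^ l)"]
    by (simp add: mult_ac)
  have m1: "(\<lambda>l. ?c l * ?t l) sums (z * S)"
    using sums_Suc[of "\<lambda>l. ?c l * ?t l"] sums_mult[OF m0, of z] by (simp only: shift) simp
  have dom: "(\<lambda>l. z * (?c l * ?t l) + z / q_int q n * ?c l) sums (z * (z * S) + z / q_int q n * S)"
    by (intro sums_add sums_mult m0 m1)
  have le: "?c (Suc l) * (?t (Suc l))\<^sup>2 \<le> z * (?c l * ?t l) + z / q_int q n * ?c l" for l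
  proof -
    have "?c (Suc l) * (?t (Suc l))\<^sup>2 = z * ?c l * ?t (Suc l)"
      by (simp only: shift power2_eq_square flip: mult.assoc)
    also have "\<dots> \<le> z * ?c l * (?t l + 1 / q_int q n)"
      using z c_nonneg by (intro mult_left_mono q_node_Suc_le q n) auto
    finally show ?thesis by (simp add: algebra_simps)
  qed
  have nonneg: "0 \<le> ?c (Suc l) * (?t (Suc l))\<^sup>2" for l
    using z c_nonneg by auto
  have summable: "summable (\<lambda>l. ?c (Suc l) * (?t (Suc l))\<^sup>2)"
    using le nonneg by (intro summable_comparison_test[OF _ sums_summable[OF dom]]) auto
  then obtain W where W: "(\<lambda>l. ?c (Suc l) * (?t (Suc l))\<^sup>2) sums W"
    by (auto simp: summable_def)
  have W_le: "W \<le> z * (z * S) + z / q_int q n * S"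
    using sums_le[OF le W dom] .
  \<comment> \<open>Restoring the term l = 0 changes nothing, since that node is 0.\<close>
  have "(\<lambda>l. ?c l * (?t l)\<^sup>2) sums W"
    using sums_Suc[OF W] by simp
  then have "(\<lambda>l. ?c l * (?t l)\<^sup>2 - 2 * x * (?c l * ?t l) + x\<^sup>2 * ?c l) sums
      (W - 2 * x * (z * S) + x\<^sup>2 * S)"
    by (intro sums_add sums_diff sums_mult m0 m1)
  then have "(\<lambda>l. ?c l * (?t l - x)\<^sup>2) sums (W - 2 * x * (z * S) + x\<^sup>2 * S)"
    by (simp add: power2_eq_square algebra_simps)
  moreover have "W - 2 * x * (z * S) + x\<^sup>2 * S \<le> ((z - x)\<^sup>2 + z / q_int q n) * S"
    using W_le by (simp add: power2_eq_square algebra_simps)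
  ultimately show ?thesis
    by (rule that)
qed

subsection \<open>Convergence of the operators\<close>

lemma q_coeff_bounded_abs_summable:
  assumes q: "0 < q" "q < 1" and n: "n \<ge> 1" and z: "0 \<le> z" "z < 1"
    and M: "\<And>t. t \<in> {0..1} \<Longrightarrow> \<bar>g t\<bar> \<le> M"
  shows "summable (\<lambda>l. \<bar>q_coeff q n l * z ^ l * g (q_node q n l)\<bar>)"
proof (rule summable_comparison_test)
  show "summable (\<lambda>l. M * (q_coeff q n l * z ^ l))"
    using q_binomial[OF q z] by (intro summable_mult) (auto simp: sums_iff)
  have "\<bar>q_coeff q n l * z ^ l * g (q_node q n l)\<bar> \<le> (q_coeff q n l * z ^ l) * M" for l
    unfolding abs_mult using q_coeff_nonneg[OF q, of n l] z
    by (intro mult_mono M q_node_in_01 q n) auto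
  then show "\<exists>N. \<forall>l\<ge>N. norm \<bar>q_coeff q n l * z ^ l * g (q_node q n l)\<bar> \<le>
      M * (q_coeff q n l * z ^ l)"
    by (simp add: mult.commute)
qed

text \<open>By the \<open>q\<close>-binomial theorem the sums over \<open>l\<^sub>2, \<dots>, l\<^sub>r\<close> cancel the corresponding
  prefactors, so only the first sequence matters.\<close>
lemma q_lagrange_hermite_eq:
  assumes r: "r \<ge> 1" and q: "0 < q" "q < 1" and n: "n \<ge> 1" and x: "x \<in> {0..1}"
    and \<alpha>: "\<And>k. k \<in> {1..r} \<Longrightarrow> \<alpha> k n \<in> {0<..<1}"
    and M: "\<And>t. t \<in> {0..1} \<Longrightarrow> \<bar>g t\<bar> \<le> M"
  defines "z \<equiv> \<alpha> 1 n * x"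
  shows "q_lagrange_hermite r \<alpha> n q g x =
    q_pochhammer z q n * (\<Sum>l. q_coeff q n l * z ^ l * g (q_node q n l))"
proof -
  let ?T = "\<Sum>l. q_coeff q n l * z ^ l * g (q_node q n l)"
  let ?z = "\<lambda>k. \<alpha> k n * x ^ k"
  \<comment> \<open>The value of g depends on \<open>l 1\<close> alone, so it is moved into the
    factor k = 1; the summand becomes a pure product over k, as
    \<open>weighted_tuples_prod_sums\<close> requires.\<close>
  let ?f = "\<lambda>k j. (q_coeff q n j * \<alpha> k n ^ j) * (if k = 1 then g (q_node q n j) else 1)"
  let ?S = "\<lambda>k. if k = 1 then ?T else 1 / q_pochhammer (?z k) q n"
  have z_bounds: "?z k < 1" "0 \<le> ?z k" if "k \<in> {1..r}" for k
  proof -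
    have "?z k \<le> \<alpha> k n * 1"
      using \<alpha>[OF that] x by (intro mult_left_mono power_le_one) auto
    also have "\<dots> < 1"
      using \<alpha>[OF that] by simp
    finally show "?z k < 1" .
    show "0 \<le> ?z k"
      using \<alpha>[OF that] x by simp
  qed
  have z: "0 \<le> z" "z < 1"
    using z_bounds[of 1] r by (auto simp: z_def)
  have "((\<lambda>j. ?f k j * x ^ (k * j)) has_sum ?S k) UNIV" if k: "k \<in> {1..r}" for k
  proof (cases "k = 1")
    case True
    \<comment> \<open>As g may change sign, this factor needs absolute convergence; for k \<noteq> 1
      all terms are non-negative.\<close>
    have s: "summable (\<lambda>l. norm (q_coeff q n l * z ^ l * g (q_node q n l)))"
      using q_coeff_bounded_abs_summable[where g = g, OF q n z M] by simp
    then have T: "((\<lambda>l. q_coeff q n l * z ^ l * g (q_node q n l)) has_sum ?T) UNIV"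
      by (rule norm_summable_imp_has_sum) (rule summable_sums[OF summable_norm_cancel[OF s]])
    have eq: "?f k j * x ^ (k * j) = q_coeff q n j * z ^ j * g (q_node q n j)" for j
      using True by (simp add: z_def power_mult_distrib)
    show ?thesis
      unfolding eq using T True by simp
  next
    case False
    have "((\<lambda>l. q_coeff q n l * ?z k ^ l) has_sum (1 / q_pochhammer (?z k) q n)) UNIV"
      using z_bounds[OF k] q_coeff_nonneg[OF q] by (intro sums_nonneg_imp_has_sum q_binomial q) auto
    also have "(\<lambda>l. q_coeff q n l * ?z k ^ l) = (\<lambda>j. ?f k j * x ^ (k * j))"
      using False by (simp add: fun_eq_iff power_mult_distrib power_mult)
    finally show ?thesis
      using False by simp
  qed
  from weighted_tuples_prod_sums[OF this]
  have sums: "(\<lambda>m. (\<Sum>l\<in>weighted_tuples r m. \<Prod>k=1..r. ?f k (l k)) * x ^ m) sums (\<Prod>k=1..r. ?S k)" .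
  have prod_f: "(\<Prod>k=1..r. ?f k (l k)) =
      (\<Prod>k=1..r. q_pochhammer (q ^ n) q (l k) * \<alpha> k n ^ l k / q_pochhammer q q (l k)) *
      g (q_int q (l 1) / q_int q (n + l 1 - 1))" for l
  proof -
    have "(\<Prod>k=1..r. if k = 1 then g (q_node q n (l k)) else 1) = g (q_node q n (l 1))"
      using r by (subst prod.delta) auto
    then show ?thesis
      unfolding prod.distrib[of _ "\<lambda>k. if k = 1 then g (q_node q n (l k)) else 1"]
      by (simp only: q_coeff_def q_node_def times_divide_eq_left)
  qed
  have "q_lagrange_hermite r \<alpha> n q g x = (\<Prod>i=1..r. q_pochhammer (?z i) q n) * (\<Prod>k=1..r. ?S k)"
    using sums_unique[OF sums] by (simp only: q_lagrange_hermite_def prod_f)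
  also have "\<dots> = (\<Prod>i=1..r. if i = 1 then q_pochhammer (?z i) q n * ?T else 1)"
    unfolding prod.distrib[symmetric]
  proof (rule prod.cong)
    fix k assume k: "k \<in> {1..r}"
    have "q_pochhammer (?z k) q n > 0"
      using q z_bounds[OF k] by (intro q_pochhammer_pos) auto
    then show "q_pochhammer (?z k) q n * ?S k = (if k = 1 then q_pochhammer (?z k) q n * ?T else 1)"
      by simp
  qed simp
  also have "\<dots> = q_pochhammer z q n * ?T"
    using r by (simp add: z_def)
  finally show ?thesis .
qed

text \<open>A Korovkin-type estimate: the quadratic bound on g is averaged against non-negative
  weights of total mass 1. The result is uniform in x because (z - x)^2 = x^2 (\<alpha> 1 n - 1)^2
  and z < 1.\<close>

lemma q_lagrange_hermite_error:
  assumes r: "r \<ge> 1" and q: "0 < q" "q < 1" and n: "n \<ge> 1" and x: "x \<in> {0..1}"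
    and \<alpha>: "\<And>k. k \<in> {1..r} \<Longrightarrow> \<alpha> k n \<in> {0<..<1}"
    and M: "\<And>t. t \<in> {0..1} \<Longrightarrow> \<bar>g t\<bar> \<le> M"
    and K: "K \<ge> 0"
    and mod: "\<And>t. t \<in> {0..1} \<Longrightarrow> \<bar>g t - g x\<bar> \<le> \<epsilon> + K * (t - x)\<^sup>2"
  shows "\<bar>q_lagrange_hermite r \<alpha> n q g x - g x\<bar> \<le> \<epsilon> + K * ((\<alpha> 1 n - 1)\<^sup>2 + 1 / q_int q n)"
proof -
  define z where "z = \<alpha> 1 n * x"
  have \<alpha>1: "0 < \<alpha> 1 n" "\<alpha> 1 n < 1"
    using \<alpha>[of 1] r by auto
  have "z \<le> \<alpha> 1 n * 1"
    unfolding z_def using \<alpha>1 x by (intro mult_left_mono) auto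
  then have z: "0 \<le> z" "z < 1"
    using \<alpha>1 x by (simp add: z_def, linarith)
  let ?c = "\<lambda>l. q_coeff q n l * z ^ l" and ?t = "q_node q n"
  define P where "P = q_pochhammer z q n"
  have P: "P > 0"
    unfolding P_def using q z by (intro q_pochhammer_pos) auto
  have c_nonneg: "?c l \<ge> 0" for l
    using q_coeff_nonneg[OF q] z by simp
  have m0: "?c sums (1 / P)"
    unfolding P_def using q z by (rule q_binomial)
  have sg: "summable (\<lambda>l. ?c l * g (?t l))"
    using q_coeff_bounded_abs_summable[where g = g, OF q n z M] by (rule summable_rabs_cancel)
  define T where "T = (\<Sum>l. ?c l * g (?t l))"
  have T: "(\<lambda>l. ?c l * g (?t l)) sums T"
    unfolding T_def using sg by (rule summable_sums)
  have "q_lagrange_hermite r \<alpha> n q g x = P * T"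
    unfolding P_def T_def z_def by (rule q_lagrange_hermite_eq[where \<alpha> = \<alpha> and g = g, OF r q n x \<alpha> M])
  \<comment> \<open>The weights sum to 1 / P, so the constant g x can be taken inside the
    series.\<close>
  then have eq: "q_lagrange_hermite r \<alpha> n q g x - g x = P * (T - g x * (1 / P))"
    using P by (simp add: right_diff_distrib)
  have diff: "(\<lambda>l. ?c l * g (?t l) - g x * ?c l) sums (T - g x * (1 / P))"
    by (intro sums_diff sums_mult T m0)
  obtain V where V: "(\<lambda>l. ?c l * (?t l - x)\<^sup>2) sums V"
      and V_le: "V \<le> ((z - x)\<^sup>2 + z / q_int q n) * (1 / P)"
    using q_second_moment[OF q n z] unfolding P_def by blast
  have dom: "(\<lambda>l. \<epsilon> * ?c l + K * (?c l * (?t l - x)\<^sup>2)) sums (\<epsilon> * (1 / P) + K * V)"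
    by (intro sums_add sums_mult m0 V)
  have le: "\<bar>?c l * g (?t l) - g x * ?c l\<bar> \<le> \<epsilon> * ?c l + K * (?c l * (?t l - x)\<^sup>2)" for l
  proof -
    have "\<bar>?c l * g (?t l) - g x * ?c l\<bar> = ?c l * \<bar>g (?t l) - g x\<bar>"
    proof -
      have "?c l * g (?t l) - g x * ?c l = ?c l * (g (?t l) - g x)"
        by (simp add: algebra_simps)
      then show ?thesis
        using c_nonneg[of l] by (simp only: abs_mult[of "?c l"] abs_of_nonneg)
    qed
    also have "\<dots> \<le> ?c l * (\<epsilon> + K * (?t l - x)\<^sup>2)"
      by (intro mult_left_mono mod q_node_in_01 q n c_nonneg)
    finally show ?thesis
      by (simp only: distrib_left mult.left_commute[of K] mult.commute[of _ \<epsilon>])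
  qed
  have "\<bar>T - g x * (1 / P)\<bar> \<le> \<epsilon> * (1 / P) + K * V"
    using norm_sums_le[OF diff dom] le by simp
  then have "\<bar>q_lagrange_hermite r \<alpha> n q g x - g x\<bar> \<le> P * (\<epsilon> * (1 / P) + K * V)"
    using P by (simp add: eq abs_mult mult_left_mono)
  also have "\<dots> = \<epsilon> + K * (P * V)"
    using P by (simp add: distrib_left)
  also have "P * V \<le> (z - x)\<^sup>2 + z / q_int q n"
    using mult_left_mono[OF V_le, of P] P by simp
  also have "(z - x)\<^sup>2 \<le> (\<alpha> 1 n - 1)\<^sup>2"
  proof -
    have "(z - x)\<^sup>2 = x\<^sup>2 * (\<alpha> 1 n - 1)\<^sup>2"
      by (simp add: z_def power2_eq_square algebra_simps)
    also have "\<dots> \<le> (\<alpha> 1 n - 1)\<^sup>2"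
      using x by (intro mult_left_le_one_le) (auto simp: power_le_one)
    finally show ?thesis .
  qed
  also have "z / q_int q n \<le> 1 / q_int q n"
    using z q_int_nonneg[OF q] by (intro divide_right_mono) auto
  finally show ?thesis
    using K by (simp add: mult_left_mono)
qed

text \<open>Nearby points are handled by uniform continuity with some d. At distance at least d, the
  trivial bound 2 M is at most 2 M (t - s)^2 / d^2, whence the choice of K.\<close>

lemma continuous_on_01_quadratic_modulus:
  fixes g :: "real \<Rightarrow> real"
  assumes "continuous_on {0..1} g" "\<epsilon> > 0"
  obtains K where "K \<ge> 0"
    and "\<And>s t. s \<in> {0..1} \<Longrightarrow> t \<in> {0..1} \<Longrightarrow> \<bar>g t - g s\<bar> \<le> \<epsilon> + K * (t - s)\<^sup>2"
proof -
  have "uniformly_continuous_on {0..1} g"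
    using assms by (intro compact_uniformly_continuous) auto
  then obtain d where d: "d > 0"
    "\<And>s t. s \<in> {0..1} \<Longrightarrow> t \<in> {0..1} \<Longrightarrow> \<bar>t - s\<bar> < d \<Longrightarrow> \<bar>g t - g s\<bar> < \<epsilon>"
    unfolding uniformly_continuous_on_def dist_real_def using \<open>\<epsilon> > 0\<close> by metis
  have "bounded (g ` {0..1})"
    using assms by (intro compact_imp_bounded compact_continuous_image) auto
  then obtain M where M: "M > 0" "\<And>t. t \<in> {0..1} \<Longrightarrow> \<bar>g t\<bar> \<le> M"
    unfolding bounded_pos by auto
  show ?thesis
  proof (rule that[of "2 * M / d\<^sup>2"])
    show "2 * M / d\<^sup>2 \<ge> 0"
      using M by simp
    fix s t :: real assume st: "s \<in> {0..1}" "t \<in> {0..1}"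
    show "\<bar>g t - g s\<bar> \<le> \<epsilon> + 2 * M / d\<^sup>2 * (t - s)\<^sup>2"
    proof (cases "\<bar>t - s\<bar> < d")
      case True
      then have "\<bar>g t - g s\<bar> < \<epsilon>"
        using d st by blast
      moreover have "0 \<le> 2 * M / d\<^sup>2 * (t - s)\<^sup>2"
        using M by simp
      ultimately show ?thesis by linarith
    next
      case False
      then have "d\<^sup>2 \<le> (t - s)\<^sup>2"
        using d(1) by (intro abs_le_square_iff[THEN iffD1]) auto
      then have "2 * M \<le> 2 * M / d\<^sup>2 * (t - s)\<^sup>2"
        using M d(1) by (simp add: field_simps)
      then show ?thesis
        using M(2)[OF st(1)] M(2)[OF st(2)] \<open>\<epsilon> > 0\<close> by linarith
    qed
  qed
qed

theorem q_lagrange_hermite_uniform_limit: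
  assumes r: "r \<ge> 1"
    and \<alpha>: "\<And>j n. j \<in> {1..r} \<Longrightarrow> n \<ge> 1 \<Longrightarrow> \<alpha> j n \<in> {0<..<1}"
    and \<alpha>_lim: "(\<lambda>n. \<alpha> 1 n) \<longlonglongrightarrow> 1"
    and q: "\<And>n. n \<ge> 1 \<Longrightarrow> q n \<in> {0<..<1}"
    and q_lim: "q \<longlonglongrightarrow> 1"
    and a: "a < 1" and qn_lim: "(\<lambda>n. q n ^ n) \<longlonglongrightarrow> a"
    and g: "continuous_on {0..1} g"
  shows "(\<lambda>n. sup_norm01 (\<lambda>x. q_lagrange_hermite r \<alpha> n (q n) g x - g x)) \<longlonglongrightarrow> 0"
proof (rule tendstoI)
  fix \<epsilon> :: real assume \<epsilon>: "\<epsilon> > 0"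
  have "bounded (g ` {0..1})"
    using g by (intro compact_imp_bounded compact_continuous_image) auto
  then obtain M where M: "\<And>t. t \<in> {0..1} \<Longrightarrow> \<bar>g t\<bar> \<le> M"
    unfolding bounded_real by blast
  \<comment> \<open>Half of \<epsilon> goes to the modulus. K is now fixed independently of n, so
    the remaining term tends to 0.\<close>
  obtain K where K: "K \<ge> 0"
    and mod: "\<And>s t. s \<in> {0..1} \<Longrightarrow> t \<in> {0..1} \<Longrightarrow> \<bar>g t - g s\<bar> \<le> \<epsilon> / 2 + K * (t - s)\<^sup>2"
    using continuous_on_01_quadratic_modulus[OF g, of "\<epsilon> / 2"] \<epsilon> by auto
  have "(\<lambda>n. 1 / q_int (q n) n) \<longlonglongrightarrow> (1 - 1) / (1 - a)"
    unfolding q_int_def divide_divide_eq_right mult_1_left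
    using a by (intro tendsto_intros q_lim qn_lim) auto
  then have "(\<lambda>n. \<epsilon> / 2 + K * ((\<alpha> 1 n - 1)\<^sup>2 + 1 / q_int (q n) n)) \<longlonglongrightarrow>
      \<epsilon> / 2 + K * ((1 - 1)\<^sup>2 + (1 - 1) / (1 - a))"
    by (intro tendsto_add tendsto_mult tendsto_const tendsto_power tendsto_diff \<alpha>_lim)
  then have "\<forall>\<^sub>F n in sequentially. \<epsilon> / 2 + K * ((\<alpha> 1 n - 1)\<^sup>2 + 1 / q_int (q n) n) < \<epsilon>"
    by (rule order_tendstoD(2)) (use \<epsilon> in simp)
  then show "\<forall>\<^sub>F n in sequentially.
      dist (sup_norm01 (\<lambda>x. q_lagrange_hermite r \<alpha> n (q n) g x - g x)) 0 < \<epsilon>"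
    using eventually_ge_at_top[of 1]
  proof eventually_elim
    case (elim n)
    let ?B = "\<epsilon> / 2 + K * ((\<alpha> 1 n - 1)\<^sup>2 + 1 / q_int (q n) n)"
    have le: "\<bar>q_lagrange_hermite r \<alpha> n (q n) g x - g x\<bar> \<le> ?B" if "x \<in> {0..1}" for x
      using r q[OF elim(2)] elim(2) that \<alpha>[OF _ elim(2)] M K mod[OF that]
      by (intro q_lagrange_hermite_error) auto
    have "sup_norm01 (\<lambda>x. q_lagrange_hermite r \<alpha> n (q n) g x - g x) \<le> ?B"
      unfolding sup_norm01_def using le by (intro cSUP_least) auto
    \<comment> \<open>The bound \<open>?B\<close> also shows that the supremum is taken over a set
      bounded above, so it dominates the value at x = 0.\<close>
    moreover have "0 \<le> sup_norm01 (\<lambda>x. q_lagrange_hermite r \<alpha> n (q n) g x - g x)"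
      unfolding sup_norm01_def using le by (intro cSUP_upper2[where x = 0]) (auto intro!: bdd_aboveI2[where M = ?B])
    ultimately show ?case
      using elim(1) by simp
  qed
qed

subsection \<open>Regularity of P-summability\<close>

lemma eventually_at_left_ereal:
  assumes "R > 0"
  shows "\<forall>\<^sub>F u in at_left_ereal R. 0 < u \<and> ereal u < R"
proof (cases R)
  case (real b)
  then have "b > 0"
    using assms by simp
  then have "\<forall>\<^sub>F u in at_left b. u \<in> {0<..<b}"
    by (rule eventually_at_left_real)
  then show ?thesis
    using real by (simp add: at_left_ereal_def)
next
  case PInf
  then show ?thesis
    using eventually_gt_at_top[of "0::real"] by (simp add: at_left_ereal_def)
qed (use assms in auto)

text \<open>The Toeplitz argument: the quotients p_n u^(n-1) / p(u) are non-negative with sum 1.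
  Regularity makes the finitely many head terms vanish in the limit, and the tail is an average of
  values below \<epsilon> / 2.\<close>

theorem P_regular_null_sequence:
  assumes p: "\<And>n. n \<ge> 1 \<Longrightarrow> p n \<ge> 0" and p_nz: "\<exists>n\<ge>1. p n \<noteq> 0"
    and R: "conv_radius_from1 p = R" "R > 0" and reg: "P_regular p R"
    and e: "e \<longlonglongrightarrow> 0"
  shows "((\<lambda>u. 1 / power_series_from1 p u * (\<Sum>n. e n * p (Suc n) * u ^ n)) \<longlongrightarrow> 0)
    (at_left_ereal R)"
proof (rule tendstoI)
  fix \<epsilon> :: real assume \<epsilon>: "\<epsilon> > 0"
  let ?w = "\<lambda>u n. p (Suc n) * u ^ n" and ?P = "power_series_from1 p"
  obtain N where N: "\<And>n. n \<ge> N \<Longrightarrow> \<bar>e n\<bar> < \<epsilon> / 2"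
    using LIMSEQ_D[OF e, of "\<epsilon> / 2"] \<epsilon> by auto
  have "((\<lambda>u. \<Sum>n<N. \<bar>e n\<bar> * (?w u n / ?P u)) \<longlongrightarrow> (\<Sum>n<N. \<bar>e n\<bar> * 0)) (at_left_ereal R)"
  proof (intro tendsto_sum tendsto_mult tendsto_const)
    show "((\<lambda>u. ?w u n / ?P u) \<longlongrightarrow> 0) (at_left_ereal R)" for n
      using reg unfolding P_regular_def by (auto dest: spec[of _ "Suc n"])
  qed
  then have "\<forall>\<^sub>F u in at_left_ereal R. (\<Sum>n<N. \<bar>e n\<bar> * (?w u n / ?P u)) < \<epsilon> / 2"
    by (rule order_tendstoD(2)) (use \<epsilon> in simp)
  then show "\<forall>\<^sub>F u in at_left_ereal R. dist (1 / ?P u * (\<Sum>n. e n * p (Suc n) * u ^ n)) 0 < \<epsilon>"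
    using eventually_at_left_ereal[OF R(2)]
  proof eventually_elim
    case (elim u)
    have w_nonneg: "?w u n \<ge> 0" for n
      using p[of "Suc n"] elim(2) by simp
    have "summable (?w u)"
      using elim(2) R(1) by (intro summable_in_conv_radius) (simp add: conv_radius_from1_def)
    then have w: "?w u sums ?P u"
      by (simp add: power_series_from1_def summable_sums)
    \<comment> \<open>One positive coefficient together with u > 0 makes p(u) positive, so dividing
      by it is legitimate.\<close>
    obtain k where k: "p (Suc k) \<noteq> 0"
      using p_nz by (metis Suc_pred' less_eq_Suc_le One_nat_def)
    then have "0 < ?w u k"
      using p[of "Suc k"] elim(2) by simp
    then have P: "?P u > 0"
      using sums_unique[OF w] suminf_pos2[OF sums_summable[OF w] w_nonneg] by simp
    \<comment> \<open>The majorant charges \<epsilon> / 2 to head indices as well, so the tail part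
      sums to a multiple of p(u) itself.\<close>
    have dom: "(\<lambda>n. (if n \<in> {..<N} then \<bar>e n\<bar> * ?w u n else 0) + \<epsilon> / 2 * ?w u n) sums
        ((\<Sum>n<N. \<bar>e n\<bar> * ?w u n) + \<epsilon> / 2 * ?P u)"
      by (intro sums_add sums_mult w sums_If_finite_set) auto
    have le: "norm (e n * p (Suc n) * u ^ n) \<le>
        (if n \<in> {..<N} then \<bar>e n\<bar> * ?w u n else 0) + \<epsilon> / 2 * ?w u n" for n
    proof -
      have eq: "norm (e n * p (Suc n) * u ^ n) = \<bar>e n\<bar> * ?w u n"
        using w_nonneg[of n] by (simp only: real_norm_def abs_mult[of "e n"] mult.assoc abs_of_nonneg)
      show ?thesis
      proof (cases "n < N")
        case True
        then show ?thesis
          unfolding eq using w_nonneg[of n] \<epsilon> by simp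
      next
        case False
        then show ?thesis
          unfolding eq using mult_right_mono[OF less_imp_le[OF N[of n]] w_nonneg[of n]] by simp
      qed
    qed
    have "summable (\<lambda>n. e n * p (Suc n) * u ^ n)"
      using le by (intro summable_comparison_test[OF _ sums_summable[OF dom]]) auto
    then have "\<bar>\<Sum>n. e n * p (Suc n) * u ^ n\<bar> \<le> (\<Sum>n<N. \<bar>e n\<bar> * ?w u n) + \<epsilon> / 2 * ?P u"
      using norm_sums_le[OF summable_sums dom le] by simp
    then have "\<bar>1 / ?P u * (\<Sum>n. e n * p (Suc n) * u ^ n)\<bar> \<le>
        (\<Sum>n<N. \<bar>e n\<bar> * (?w u n / ?P u)) + \<epsilon> / 2"
      using P by (simp add: abs_mult field_simps flip: sum_divide_distrib)
    then show ?case
      using elim(1) by simp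
  qed
qed

theorem mainTheorem9:
  fixes r :: nat and \<alpha> :: "nat \<Rightarrow> nat \<Rightarrow> real" and q p :: "nat \<Rightarrow> real"
    and a :: real and R :: ereal and g :: "real \<Rightarrow> real"
  assumes "r \<ge> 1"
    and "\<And>j n. j \<in> {1..r} \<Longrightarrow> n \<ge> 1 \<Longrightarrow> \<alpha> j n \<in> {0<..<1}"
    and "(\<lambda>n. \<alpha> 1 n) \<longlonglongrightarrow> 1"
    and "\<And>n. n \<ge> 1 \<Longrightarrow> q n \<in> {0<..<1}"
    and "q \<longlonglongrightarrow> 1"
    and "a \<in> {0..<1}"
    and "(\<lambda>n. q n ^ n) \<longlonglongrightarrow> a"
    and "\<And>n. n \<ge> 1 \<Longrightarrow> p n \<ge> 0"
    and "\<exists>n\<ge>1. p n \<noteq> 0"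
    and "conv_radius_from1 p = R"
    and "R > 0"
    and "P_regular p R"
    and "continuous_on {0..1} g"
  shows "((\<lambda>u. 1 / power_series_from1 p u *
            (\<Sum>n. sup_norm01 (\<lambda>x. q_lagrange_hermite r \<alpha> (Suc n) (q (Suc n)) g x - g x)
                    * p (Suc n) * u ^ n))
          \<longlongrightarrow> 0) (at_left_ereal R)"
proof (rule P_regular_null_sequence)
  have "(\<lambda>n. sup_norm01 (\<lambda>x. q_lagrange_hermite r \<alpha> n (q n) g x - g x)) \<longlonglongrightarrow> 0"
    by (rule q_lagrange_hermite_uniform_limit) (use assms in auto)
  \<comment> \<open>The summation index starts at 0 while operators and coefficients start at 1,
    hence the shift.\<close>
  then show "(\<lambda>n. sup_norm01 (\<lambda>x. q_lagrange_hermite r \<alpha> (Suc n) (q (Suc n)) g x - g x)) \<longlonglongrightarrow> 0"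
    by (rule LIMSEQ_Suc)
qed (use assms in auto)

end
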